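(* Let $k\ge 1$, let $\mathcal{P}=(p_j)_{j=1}^l$ be a downward-right path in $T_1\subset L_k^2$ from $p_1=(1,k)$ to $p_l=(a,b)$ ($a\le b$), and let $\mathcal{Q}=(q_j)_{j=1}^l$ be its reflection in the diagonal. Let $F:L_k^2\to L_k$ be defined as follows. (1) For $(x,y)\notin\mathcal{P}\cup\mathcal{Q}\cup[a,b]^2$: $F(x,y)=x\vee y$ if $(x,y)$ is above $\mathcal{P}\cup\mathcal{Q}$, and $F(x,y)=x\wedge y$ if $(x,y)$ is below $\mathcal{P}\cup\mathcal{Q}$. (2) On $[a,b]^2$ (including $p_l=(a,b)$ and $q_l=(b,a)$), $F$ is uniformly one of the projections: either $F(x,y)=x$ for all $(x,y)\in[a,b]^2$, or $F(x,y)=y$ for all $(x,y)\in[a,b]^2$. (3) For $i\in\{1,\dots,l-1\}$: if $\overline{p_i,p_{i+1}}$ is horizontal, then $F(x,y)=x\wedge y$ for $(x,y)\in\{p_i,q_i\}$; if $\overline{p_i,p_{i+1}}$ is vertical, then $F(x,y)=x\vee y$ for $(x,y)\in\{p_i,q_i\}$; if $\overline{p_i,p_{i+1}}$ is diagonal and $p_i=(x,y)$, then $F(x,y)\in\{x,y\}$ is chosen arbitrarily, and the value at $q_i=(y,x)$ is determined by $F(y,x)\in\{x,y\}$ and $F(y,x)\neq F(x,y)$. Then $F$ is associative, quasitrivial and nondecreasing.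
   Context: $L_k=\{1,\dots,k\}$ with the natural order; $[a,b]=\{m\in L_k: a\le m\le b\}$; $x\wedge y=\min\{x,y\}$, $x\vee y=\max\{x,y\}$; $T_1=\{(x,y)\in L_k^2: x\le y\}$. An operation $F:L_k^2\to L_k$ is quasitrivial if $F(x,y)\in\{x,y\}$ for all $x,y$; associative if $F(F(x,y),z)=F(x,F(y,z))$ for all $x,y,z$; nondecreasing if $F(x,y)\le F(x',y')$ whenever $x\le x'$ and $y\le y'$. A downward-right path is a finite sequence of points $(p_j)_{j=1}^l$ of $L_k^2$ such that each step from $p_j=(x,y)$ to $p_{j+1}$ goes to $(x+1,y)$ (the segment $\overline{p_j,p_{j+1}}$ is horizontal), to $(x,y-1)$ (vertical), or to $(x+1,y-1)$ (diagonal). We identify $\mathcal{P}$ with its set of points $\{p_1,\dots,p_l\}$. The reflection of $\mathcal{P}$ in the diagonal is $\mathcal{Q}=(q_j)_{j=1}^l$, where $q_j=(y,x)$ if $p_j=(x,y)$. Let $\mathcal{P}$ be a downward-right path from $(1,k)$ to $(a,b)$, $a\le b$, with reflection $\mathcal{Q}$, and let $(x,y)\in L_k^2\setminus(\mathcal{P}\cup\mathcal{Q}\cup[a,b]^2)$. Then $(x,y)$ is above $\mathcal{P}\cup\mathcal{Q}$ if there is $(x,w)\in\mathcal{P}$ with $y>w$, or there is $(w,y)\in\mathcal{Q}$ with $x>w$, or both $x>a$ and $y>a$. It is below $\mathcal{P}\cup\mathcal{Q}$ if there is $(x,w)\in\mathcal{P}$ with $y<w$, or there is $(w,y)\in\mathcal{Q}$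 with $x<w$. *)

theory Defs
  imports Main
begin

definition L :: "nat \<Rightarrow> nat set" where
  "L k = {1..k}"

definition T1 :: "nat \<Rightarrow> (nat \<times> nat) set" where
  "T1 k = {(x, y). x \<in> L k \<and> y \<in> L k \<and> x \<le> y}"

definition quasitrivial_on :: "nat set \<Rightarrow> (nat \<Rightarrow> nat \<Rightarrow> nat) \<Rightarrow> bool" where
  "quasitrivial_on A F \<longleftrightarrow> (\<forall>x\<in>A. \<forall>y\<in>A. F x y \<in> {x, y})"

definition associative_on :: "nat set \<Rightarrow> (nat \<Rightarrow> nat \<Rightarrow> nat) \<Rightarrow> bool" where
  "associative_on A F \<longleftrightarrow> (\<forall>x\<in>A. \<forall>y\<in>A. \<forall>z\<in>A. F (F x y) z = F x (F y z))"

definition nondecreasing_on :: "nat set \<Rightarrow> (nat \<Rightarrow> nat \<Rightarrow> nat) \<Rightarrow> bool" where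
  "nondecreasing_on A F \<longleftrightarrow>
     (\<forall>x\<in>A. \<forall>x'\<in>A. \<forall>y\<in>A. \<forall>y'\<in>A. x \<le> x' \<and> y \<le> y' \<longrightarrow> F x y \<le> F x' y')"

text \<open>
  The kinds of segment from a point \<open>p\<close> to the next point \<open>q\<close> of a path. The downward step
  is written \<open>snd p = Suc (snd q)\<close> to avoid truncated subtraction.
\<close>

definition horizontal_step :: "nat \<times> nat \<Rightarrow> nat \<times> nat \<Rightarrow> bool" where
  "horizontal_step p q \<longleftrightarrow> fst q = Suc (fst p) \<and> snd q = snd p"

definition vertical_step :: "nat \<times> nat \<Rightarrow> nat \<times> nat \<Rightarrow> bool" where
  "vertical_step p q \<longleftrightarrow> fst q = fst p \<and> snd p = Suc (snd q)"

definition diagonal_step :: "nat \<times> nat \<Rightarrow> nat \<times> nat \<Rightarrow> bool" where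
  "diagonal_step p q \<longleftrightarrow> fst q = Suc (fst p) \<and> snd p = Suc (snd q)"

text \<open>
  A path $(p_j)_{j=1}^l$ is the list of its points, so \<open>ps ! i\<close> is $p_{i+1}$ and
  \<open>set ps\<close> is the path regarded as a set of points.
\<close>

definition downward_right_path :: "nat \<Rightarrow> (nat \<times> nat) list \<Rightarrow> bool" where
  "downward_right_path k ps \<longleftrightarrow> ps \<noteq> [] \<and> set ps \<subseteq> L k \<times> L k \<and>
     (\<forall>i. Suc i < length ps \<longrightarrow>
        horizontal_step (ps ! i) (ps ! Suc i) \<or>
        vertical_step (ps ! i) (ps ! Suc i) \<or>
        diagonal_step (ps ! i) (ps ! Suc i))"

definition reflection :: "(nat \<times> nat) list \<Rightarrow> (nat \<times> nat) list" where
  "reflection ps = map prod.swap ps"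

text \<open>
  In the following, \<open>ps\<close> is meant to be a downward-right path from \<open>(1, k)\<close> to \<open>(a, b)\<close>;
  then \<open>a\<close> and \<open>b\<close> lie in \<open>L k\<close>, so the interval $[a,b]$ of $L_k$ is \<open>{a..b}\<close>.
\<close>

definition off_path :: "nat \<Rightarrow> nat \<Rightarrow> nat \<Rightarrow> (nat \<times> nat) list \<Rightarrow> (nat \<times> nat) set" where
  "off_path k a b ps =
     (L k \<times> L k) - (set ps \<union> set (reflection ps) \<union> {a..b} \<times> {a..b})"

definition above_path :: "nat \<Rightarrow> nat \<Rightarrow> nat \<Rightarrow> (nat \<times> nat) list \<Rightarrow> nat \<Rightarrow> nat \<Rightarrow> bool" where
  "above_path k a b ps x y \<longleftrightarrow> (x, y) \<in> off_path k a b ps \<and>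
     ((\<exists>w. (x, w) \<in> set ps \<and> y > w) \<or>
      (\<exists>w. (w, y) \<in> set (reflection ps) \<and> x > w) \<or>
      (x > a \<and> y > a))"

definition below_path :: "nat \<Rightarrow> nat \<Rightarrow> nat \<Rightarrow> (nat \<times> nat) list \<Rightarrow> nat \<Rightarrow> nat \<Rightarrow> bool" where
  "below_path k a b ps x y \<longleftrightarrow> (x, y) \<in> off_path k a b ps \<and>
     ((\<exists>w. (x, w) \<in> set ps \<and> y < w) \<or>
      (\<exists>w. (w, y) \<in> set (reflection ps) \<and> x < w))"

end

theory Submission
  imports Defs
begin

text \<open>
  Read the path from \<open>(a, b)\<close> backwards: at a point \<open>(x, y)\<close> the operation is extended
  from a smaller interval to the interval \<open>{x..y}\<close>. A horizontal step adds \<open>x\<close> as an annihilator,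
  a vertical step adds \<open>y\<close> as an annihilator, and a diagonal step adds \<open>{x, y}\<close> as an ideal on which
  the operation is a projection. Each of these extensions preserves associativity,
  quasitriviality and monotonicity.
\<close>

section \<open>Passage to the opposite operation\<close>

lemma associative_on_opposite:
  "associative_on A (\<lambda>x y. F y x) \<longleftrightarrow> associative_on A F"
  unfolding associative_on_def by metis

lemma quasitrivial_on_opposite:
  "quasitrivial_on A (\<lambda>x y. F y x) \<longleftrightarrow> quasitrivial_on A F"
  unfolding quasitrivial_on_def by blast

lemma nondecreasing_on_opposite:
  "nondecreasing_on A (\<lambda>x y. F y x) \<longleftrightarrow> nondecreasing_on A F"
  unfolding nondecreasing_on_def by blast

section \<open>Adjoining an ideal of left zeros\<close>

lemma quasitrivial_on_adjoin_left_zeros: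
  assumes "\<And>e u. e \<in> E \<Longrightarrow> u \<in> A \<Longrightarrow> F e u = e"
    and "\<And>e u. e \<in> E \<Longrightarrow> u \<in> A - E \<Longrightarrow> F u e = e"
    and "quasitrivial_on (A - E) F"
  shows "quasitrivial_on A F"
  using assms unfolding quasitrivial_on_def by (metis Diff_iff insertCI)

text \<open>Both bracketings of a triple return its leftmost factor in \<open>E\<close>: a left zero
  absorbs what follows and, by \<open>right\<close>, also what precedes it from outside
  \<open>E\<close>. A triple avoiding \<open>E\<close> is covered by \<open>assoc\<close>.\<close>

lemma associative_on_adjoin_left_zeros:
  assumes left: "\<And>e u. e \<in> E \<Longrightarrow> u \<in> A \<Longrightarrow> F e u = e"
    and right: "\<And>e u. e \<in> E \<Longrightarrow> u \<in> A - E \<Longrightarrow> F u e = e"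
    and qt: "quasitrivial_on (A - E) F"
    and assoc: "associative_on (A - E) F"
  shows "associative_on A F"
  unfolding associative_on_def
proof (intro ballI)
  fix u v w assume A: "u \<in> A" "v \<in> A" "w \<in> A"
  \<comment> \<open>Quasitriviality makes \<open>A - E\<close> closed, so \<open>F u v\<close> still
    lies outside \<open>E\<close> when only \<open>w\<close> belongs to \<open>E\<close>.\<close>
  have closed: "F s t \<in> A - E" if "s \<in> A - E" "t \<in> A - E" for s t
    using qt that unfolding quasitrivial_on_def by (metis insertE singletonD)
  have "F v w \<in> A"
    using quasitrivial_on_adjoin_left_zeros[OF left right qt] A
    unfolding quasitrivial_on_def by (metis insertE singletonD)
  consider "u \<in> E" | "u \<in> A - E" "v \<in> E" | "u \<in> A - E" "v \<in> A - E" "w \<in> E"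
    | "u \<in> A - E" "v \<in> A - E" "w \<in> A - E"
    using A by blast
  then show "F (F u v) w = F u (F v w)"
  proof cases
    case 1
    then show ?thesis using left A \<open>F v w \<in> A\<close> by simp
  next
    case 2
    then show ?thesis using left right A by simp
  next
    case 3
    then show ?thesis using right[of w] closed[of u v] by simp
  next
    case 4
    then show ?thesis using assoc unfolding associative_on_def by blast
  qed
qed

section \<open>Enlarging an interval by one or both endpoints\<close>

definition good_on :: "nat set \<Rightarrow> (nat \<Rightarrow> nat \<Rightarrow> nat) \<Rightarrow> bool" where
  "good_on A F \<longleftrightarrow> associative_on A F \<and> quasitrivial_on A F \<and> nondecreasing_on A F"

lemma good_on_opposite: "good_on A (\<lambda>x y. F y x) \<longleftrightarrow> good_on A F"
  unfolding good_on_def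
  using associative_on_opposite[of A F] quasitrivial_on_opposite[of A F]
    nondecreasing_on_opposite[of A F]
  by blast

lemma good_on_projection:
  assumes "(\<forall>x\<in>A. \<forall>y\<in>A. F x y = x) \<or> (\<forall>x\<in>A. \<forall>y\<in>A. F x y = y)"
  shows "good_on A F"
  using assms
  unfolding good_on_def associative_on_def quasitrivial_on_def nondecreasing_on_def by auto

text \<open>A two-sided annihilator is a singleton ideal of left zeros. Monotonicity survives
  because the new row and column are the lowest ones and carry the least possible value
  \<open>x\<close>.\<close>

lemma good_on_adjoin_least:
  assumes zero: "\<And>u. u \<in> {x..y} \<Longrightarrow> F x u = x \<and> F u x = x"
    and good: "good_on {Suc x..y} F"
  shows "good_on {x..y} F"
proof -
  have diff: "{x..y} - {x} = {Suc x..y}" by auto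
  have qt: "quasitrivial_on {x..y} F"
    by (rule quasitrivial_on_adjoin_left_zeros[where E = "{x}"])
      (use zero good diff in \<open>auto simp: good_on_def\<close>)
  have "associative_on {x..y} F"
    by (rule associative_on_adjoin_left_zeros[where E = "{x}"])
      (use zero good diff in \<open>auto simp: good_on_def\<close>)
  moreover have "nondecreasing_on {x..y} F"
    unfolding nondecreasing_on_def
  proof (intro ballI impI)
    fix u u' v v'
    assume I: "u \<in> {x..y}" "u' \<in> {x..y}" "v \<in> {x..y}" "v' \<in> {x..y}" and le: "u \<le> u' \<and> v \<le> v'"
    have "F u' v' \<ge> x"
      using qt I unfolding quasitrivial_on_def by (metis atLeastAtMost_iff insertE singletonD)
    moreover have "F u v \<le> F u' v'" if "u \<noteq> x" "v \<noteq> x"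
    proof -
      have "u \<in> {Suc x..y}" "u' \<in> {Suc x..y}" "v \<in> {Suc x..y}" "v' \<in> {Suc x..y}"
        using that I le by auto
      then show ?thesis
        using good le unfolding good_on_def nondecreasing_on_def by blast
    qed
    ultimately show "F u v \<le> F u' v'"
      using zero I by (cases "u = x \<or> v = x") auto
  qed
  ultimately show ?thesis using qt unfolding good_on_def by blast
qed

text \<open>Order dual of the previous extension: the new row and column are the highest ones and
  carry the greatest possible value.\<close>

lemma good_on_adjoin_greatest:
  assumes zero: "\<And>u. u \<in> {x..Suc y} \<Longrightarrow> F (Suc y) u = Suc y \<and> F u (Suc y) = Suc y"
    and good: "good_on {x..y} F"
  shows "good_on {x..Suc y} F"
proof -
  have diff: "{x..Suc y} - {Suc y} = {x..y}" by auto
  have qt: "quasitrivial_on {x..Suc y} F"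
    by (rule quasitrivial_on_adjoin_left_zeros[where E = "{Suc y}"])
      (use zero good diff in \<open>auto simp: good_on_def\<close>)
  have "associative_on {x..Suc y} F"
    by (rule associative_on_adjoin_left_zeros[where E = "{Suc y}"])
      (use zero good diff in \<open>auto simp: good_on_def\<close>)
  moreover have "nondecreasing_on {x..Suc y} F"
    unfolding nondecreasing_on_def
  proof (intro ballI impI)
    fix u u' v v'
    assume I: "u \<in> {x..Suc y}" "u' \<in> {x..Suc y}" "v \<in> {x..Suc y}" "v' \<in> {x..Suc y}"
      and le: "u \<le> u' \<and> v \<le> v'"
    have "F u v \<le> Suc y"
      using qt I unfolding quasitrivial_on_def by (metis atLeastAtMost_iff insertE singletonD)
    moreover have "F u v \<le> F u' v'" if "u' \<noteq> Suc y" "v' \<noteq> Suc y"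
    proof -
      have "u \<in> {x..y}" "u' \<in> {x..y}" "v \<in> {x..y}" "v' \<in> {x..y}"
        using that I le by auto
      then show ?thesis
        using good le unfolding good_on_def nondecreasing_on_def by blast
    qed
    ultimately show "F u v \<le> F u' v'"
      using zero I by (cases "u' = Suc y \<or> v' = Suc y") auto
  qed
  ultimately show ?thesis using qt unfolding good_on_def by blast
qed

text \<open>The pair \<open>{x, Suc y}\<close> is an ideal of left zeros, and outside the inner
  square \<open>F\<close> takes only the extreme values \<open>x\<close> and \<open>Suc y\<close>,
  which is what monotonicity rests on.\<close>

lemma good_on_adjoin_left_zero_pair:
  assumes left: "\<And>u. u \<in> {x..Suc y} \<Longrightarrow> F x u = x \<and> F (Suc y) u = Suc y"
    and right: "\<And>u. u \<in> {Suc x..y} \<Longrightarrow> F u x = x \<and> F u (Suc y) = Suc y"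
    and good: "good_on {Suc x..y} F"
  shows "good_on {x..Suc y} F"
proof -
  have diff: "{x..Suc y} - {x, Suc y} = {Suc x..y}" by auto
  have qt: "quasitrivial_on {x..Suc y} F"
    by (rule quasitrivial_on_adjoin_left_zeros[where E = "{x, Suc y}"])
      (use left right good diff in \<open>auto simp: good_on_def\<close>)
  have "associative_on {x..Suc y} F"
    by (rule associative_on_adjoin_left_zeros[where E = "{x, Suc y}"])
      (use left right good diff in \<open>auto simp: good_on_def\<close>)
  moreover have "nondecreasing_on {x..Suc y} F"
    unfolding nondecreasing_on_def
  proof (intro ballI impI)
    fix u u' v v'
    assume I: "u \<in> {x..Suc y}" "u' \<in> {x..Suc y}" "v \<in> {x..Suc y}" "v' \<in> {x..Suc y}"
      and le: "u \<le> u' \<and> v \<le> v'"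
    have bounds: "F s t \<in> {x..Suc y}" if "s \<in> {x..Suc y}" "t \<in> {x..Suc y}" for s t
      using qt that unfolding quasitrivial_on_def by (metis insertE singletonD)
    \<comment> \<open>Either the lower point has the least value, or the upper point has the
      greatest, or both are interior. The first argument wins on the pair, hence the exceptions
      \<open>u \<noteq> Suc y\<close> and \<open>u' \<noteq> x\<close>; these are harmless, since
      \<open>u = Suc y\<close> forces \<open>u' = Suc y\<close> and \<open>u' = x\<close> forces
      \<open>u = x\<close>.\<close>
    consider "u = x \<or> u \<noteq> Suc y \<and> v = x"
      | "u' = Suc y \<or> u' \<noteq> x \<and> v' = Suc y"
      | "u \<in> {Suc x..y}" "u' \<in> {Suc x..y}" "v \<in> {Suc x..y}" "v' \<in> {Suc x..y}"
    proof -
      have *: "s \<in> {Suc x..y}" if "s \<in> {x..Suc y}" "s \<noteq> x" "s \<noteq> Suc y" for s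
        using that by auto
      have "u' = Suc y" if "u = Suc y" "u' \<in> {x..Suc y}"
        using that le by simp
      moreover have "v' = Suc y" if "v = Suc y" "v' \<in> {x..Suc y}"
        using that le by simp
      moreover have "u = x" if "u' = x" "u \<in> {x..Suc y}"
        using that le by simp
      moreover have "v = x" if "v' = x" "v \<in> {x..Suc y}"
        using that le by simp
      ultimately show thesis using that I * by metis
    qed
    then show "F u v \<le> F u' v'"
    proof cases
      case 1
      then have "F u v = x" using left[of v] right[of u] I by (cases "u = x") auto
      then show ?thesis using bounds[of u' v'] I by simp
    next
      case 2
      then have "F u' v' = Suc y" using left[of v'] right[of u'] I by (cases "u' = Suc y") auto
      then show ?thesis using bounds[of u v] I by simp
    next
      case 3
      then show ?thesis using good le unfolding good_on_def nondecreasing_on_def by blast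
    qed
  qed
  ultimately show ?thesis using qt unfolding good_on_def by blast
qed

text \<open>Unequal corner values leave two possibilities: \<open>F\<close> is the first projection
  on \<open>{x, Suc y}\<close>, making both elements left zeros, or the second, making both right
  zeros. The latter is the former for the opposite operation.\<close>

lemma good_on_adjoin_pair:
  assumes xy: "x \<le> y"
    and lo: "\<And>u. u \<in> {x..y} \<Longrightarrow> F x u = x \<and> F u x = x"
    and hi: "\<And>u. u \<in> {Suc x..Suc y} \<Longrightarrow> F (Suc y) u = Suc y \<and> F u (Suc y) = Suc y"
    and corner: "F x (Suc y) \<in> {x, Suc y}" "F (Suc y) x \<in> {x, Suc y}" "F (Suc y) x \<noteq> F x (Suc y)"
    and good: "good_on {Suc x..y} F"
  shows "good_on {x..Suc y} F"
proof (cases "F x (Suc y) = x")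
  case True
  then have eq: "F (Suc y) x = Suc y" using corner by auto
  have "F x u = x \<and> F (Suc y) u = Suc y" if "u \<in> {x..Suc y}" for u
    using that True eq lo[of u] hi[of u] lo[of x] hi[of "Suc y"] xy
    by (cases "u = x"; cases "u = Suc y") auto
  then show ?thesis
    using good_on_adjoin_left_zero_pair[of x y F] xy lo hi good by simp
next
  case False
  then have eq: "F x (Suc y) = Suc y" "F (Suc y) x = x" using corner by auto
  have "F u x = x \<and> F u (Suc y) = Suc y" if "u \<in> {x..Suc y}" for u
    using that eq lo[of u] hi[of u] lo[of x] hi[of "Suc y"] xy
    by (cases "u = x"; cases "u = Suc y") auto
  then have "good_on {x..Suc y} (\<lambda>x y. F y x)"
    using good_on_adjoin_left_zero_pair[of x y "\<lambda>x y. F y x"] xy lo hi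
      good_on_opposite[of "{Suc x..y}" F] good
    by simp
  then show ?thesis using good_on_opposite[of "{x..Suc y}" F] by blast
qed

section \<open>Geometry of downward-right paths\<close>

lemma path_step:
  assumes "downward_right_path k ps" "Suc i < length ps"
  obtains (horizontal) x y where "ps ! i = (x, y)" "ps ! Suc i = (Suc x, y)"
      "horizontal_step (ps ! i) (ps ! Suc i)"
    | (vertical) x y where "ps ! i = (x, Suc y)" "ps ! Suc i = (x, y)"
      "vertical_step (ps ! i) (ps ! Suc i)"
    | (diagonal) x y where "ps ! i = (x, Suc y)" "ps ! Suc i = (Suc x, y)"
      "diagonal_step (ps ! i) (ps ! Suc i)"
proof -
  have "horizontal_step (ps ! i) (ps ! Suc i) \<or> vertical_step (ps ! i) (ps ! Suc i)
      \<or> diagonal_step (ps ! i) (ps ! Suc i)"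
    using assms unfolding downward_right_path_def by blast
  then show thesis
    using that
    unfolding horizontal_step_def vertical_step_def diagonal_step_def
    by (metis prod.collapse)
qed

lemma path_antitone:
  assumes "downward_right_path k ps" "i \<le> j" "j < length ps"
  shows "fst (ps ! i) \<le> fst (ps ! j) \<and> snd (ps ! j) \<le> snd (ps ! i)"
  using assms(2,3)
proof (induction j rule: dec_induct)
  case base
  then show ?case by simp
next
  case (step j)
  then have "Suc j < length ps" by simp
  from assms(1) this show ?case
    by (cases rule: path_step) (use step in auto)
qed

text \<open>A discrete intermediate value argument: the first coordinate grows by at most one at
  each step, so no column is skipped.\<close>

lemma path_column_nonempty:
  assumes path: "downward_right_path k ps" and ij: "i \<le> j" "j < length ps"
    and z: "fst (ps ! i) \<le> z" "z \<le> fst (ps ! j)"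
  obtains m where "i \<le> m" "m \<le> j" "fst (ps ! m) = z"
proof -
  have "\<exists>m. i \<le> m \<and> m \<le> j \<and> fst (ps ! m) = z"
    using ij z
  proof (induction j rule: dec_induct)
    case base
    then show ?case by auto
  next
    case (step j)
    show ?case
    proof (cases "z = fst (ps ! Suc j)")
      case True
      then show ?thesis using step.hyps by (intro exI[of _ "Suc j"]) auto
    next
      case False
      have "z \<le> fst (ps ! j)"
        using path \<open>Suc j < length ps\<close> by (cases rule: path_step) (use False step.prems in auto)
      then show ?thesis using step by (metis Suc_lessD le_SucI)
    qed
  qed
  then show thesis using that by blast
qed

text \<open>A path point comes no later than \<open>ps ! i\<close> or no earlier than
  \<open>ps ! Suc i\<close>, and both coordinates are monotone along the path. This certifies that
  points beside a step are off the path.\<close>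

lemma path_dichotomy:
  assumes path: "downward_right_path k ps" and i: "Suc i < length ps" and uv: "(u, v) \<in> set ps"
  shows "u \<le> fst (ps ! i) \<and> snd (ps ! i) \<le> v \<or> fst (ps ! Suc i) \<le> u \<and> v \<le> snd (ps ! Suc i)"
proof -
  obtain j where j: "j < length ps" "ps ! j = (u, v)"
    using uv by (metis in_set_conv_nth)
  show ?thesis
    using path_antitone[OF path, of j i] path_antitone[OF path, of "Suc i" j] i j
    by (cases "j \<le> i") auto
qed

lemma mem_set_reflection: "(x, y) \<in> set (reflection ps) \<longleftrightarrow> (y, x) \<in> set ps"
  unfolding reflection_def by force

section \<open>The operation determined by a path\<close>

theorem theorem4p13:
  fixes k a b :: nat
    and ps :: "(nat \<times> nat) list"
    and F :: "nat \<Rightarrow> nat \<Rightarrow> nat"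
  assumes k: "k \<ge> 1"
    and path: "downward_right_path k ps"
    and path_T1: "set ps \<subseteq> T1 k"
    and path_start: "hd ps = (1, k)"
    and path_end: "last ps = (a, b)"
    and ab: "a \<le> b"
    and F_closed: "\<forall>x\<in>L k. \<forall>y\<in>L k. F x y \<in> L k"
    and F_above: "\<forall>(x, y)\<in>off_path k a b ps. above_path k a b ps x y \<longrightarrow> F x y = max x y"
    and F_below: "\<forall>(x, y)\<in>off_path k a b ps. below_path k a b ps x y \<longrightarrow> F x y = min x y"
    and F_box: "(\<forall>x\<in>{a..b}. \<forall>y\<in>{a..b}. F x y = x) \<or> (\<forall>x\<in>{a..b}. \<forall>y\<in>{a..b}. F x y = y)"
    and F_horizontal: "\<forall>i. Suc i < length ps \<and> horizontal_step (ps ! i) (ps ! Suc i) \<longrightarrow>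
           (\<forall>(x, y)\<in>{ps ! i, reflection ps ! i}. F x y = min x y)"
    and F_vertical: "\<forall>i. Suc i < length ps \<and> vertical_step (ps ! i) (ps ! Suc i) \<longrightarrow>
           (\<forall>(x, y)\<in>{ps ! i, reflection ps ! i}. F x y = max x y)"
    and F_diagonal: "\<forall>i. Suc i < length ps \<and> diagonal_step (ps ! i) (ps ! Suc i) \<longrightarrow>
           (\<forall>x y. ps ! i = (x, y) \<longrightarrow>
              F x y \<in> {x, y} \<and> F y x \<in> {x, y} \<and> F y x \<noteq> F x y)"
  shows "associative_on (L k) F \<and> quasitrivial_on (L k) F \<and> nondecreasing_on (L k) F"
proof -
  let ?l = "length ps - 1"
  have ne: "ps \<noteq> []" using path unfolding downward_right_path_def by blast
  then have l: "?l < length ps" "\<And>i. Suc i < length ps \<Longrightarrow> Suc i \<le> ?l" by auto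
  have last: "ps ! ?l = (a, b)" using path_end ne by (simp add: last_conv_nth)
  have sub: "u \<in> L k \<and> v \<in> L k \<and> u \<le> v" if "(u, v) \<in> set ps" for u v
    using path_T1 that unfolding T1_def by auto
  \<comment> \<open>As the path lies in \<open>T1 k\<close>, it can contain \<open>(v, u)\<close>
    only if \<open>u = v\<close>, which \<open>(u, v) \<notin> set ps\<close> rules out. The last
    condition keeps both points out of the box.\<close>
  have off: "(u, v) \<in> off_path k a b ps \<and> (v, u) \<in> off_path k a b ps"
    if "u \<in> L k" "v \<in> L k" "u \<le> v" "(u, v) \<notin> set ps" "u < a \<or> b < v" for u v
    using that sub[of v u] unfolding off_path_def
    by (auto simp: mem_set_reflection dest: le_antisym)
  \<comment> \<open>Reflection turns a path point in column \<open>u\<close> into a point in row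
    \<open>u\<close>, so one witness \<open>w\<close> settles both \<open>(u, v)\<close> and
    \<open>(v, u)\<close>.\<close>
  have below: "F u v = u \<and> F v u = u"
    if "u \<in> L k" "v \<in> L k" "u \<le> v" "(u, v) \<notin> set ps" "u < a \<or> b < v"
      "(u, w) \<in> set ps" "v < w" for u v w
  proof -
    have "below_path k a b ps u v" "below_path k a b ps v u"
      using off[OF that(1-5)] that unfolding below_path_def
      by (auto simp: mem_set_reflection)
    then show ?thesis using F_below off[OF that(1-5)] \<open>u \<le> v\<close> by fastforce
  qed
  have above: "F u v = v \<and> F v u = v"
    if "u \<in> L k" "v \<in> L k" "u \<le> v" "(u, v) \<notin> set ps" "u < a \<or> b < v"
      "a < u \<or> (\<exists>w<v. (u, w) \<in> set ps)" for u v
  proof -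
    have "above_path k a b ps u v" "above_path k a b ps v u"
      using off[OF that(1-5)] that unfolding above_path_def
      by (auto simp: mem_set_reflection)
    then show ?thesis using F_above off[OF that(1-5)] \<open>u \<le> v\<close> by fastforce
  qed
  \<comment> \<open>A step leaving column \<open>x\<close> makes \<open>ps ! i\<close> the lowest
    path point there, so the points of the column under it are off the path and below it.\<close>
  have lo: "F x u = x \<and> F u x = x"
    if i: "Suc i < length ps" and p: "ps ! i = (x, y)" "fst (ps ! Suc i) = Suc x"
      and u: "x \<le> u" "u < y" for i x y u
  proof -
    have mem: "(x, y) \<in> set ps" using i p(1) by (metis Suc_lessD nth_mem)
    have "(x, u) \<notin> set ps"
      using path_dichotomy[OF path i, of x u] p u by auto
    moreover have "x < a"
      using path_antitone[OF path, of "Suc i" ?l] i p(2) last l by auto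
    moreover have "u \<in> L k" using sub[OF mem] u unfolding L_def by auto
    ultimately show ?thesis using below[of x u y] sub[OF mem] mem u by simp
  qed
  have hi: "F (Suc y) u = Suc y \<and> F u (Suc y) = Suc y"
    if i: "Suc i < length ps" and p: "ps ! i = (x, Suc y)" "snd (ps ! Suc i) = y"
      and u: "x < u \<or> fst (ps ! Suc i) = u" "u \<le> Suc y" "(u, Suc y) \<notin> set ps" for i x y u
  proof -
    have mem: "(x, Suc y) \<in> set ps" using i p(1) by (metis Suc_lessD nth_mem)
    have step: "fst (ps ! Suc i) \<in> {x, Suc x}"
      using path i by (cases rule: path_step) (use p in auto)
    have "b < Suc y"
      using path_antitone[OF path, of "Suc i" ?l] i p(2) last l by auto
    moreover have "u \<in> L k" "Suc y \<in> L k"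
      using sub[OF mem] u step unfolding L_def by auto
    \<comment> \<open>Column \<open>u\<close> is either beyond the end of the path or met after the
      descent from row \<open>Suc y\<close>, hence at a smaller height.\<close>
    moreover have "a < u \<or> (\<exists>w<Suc y. (u, w) \<in> set ps)"
    proof (cases "a < u")
      case False
      have "fst (ps ! Suc i) \<le> u" using u step by auto
      then obtain m where m: "Suc i \<le> m" "m \<le> ?l" "fst (ps ! m) = u"
        using path_column_nonempty[OF path, of "Suc i" ?l u] False i last l by auto
      then have "m < length ps" using i by simp
      then have "snd (ps ! m) < Suc y" "(u, snd (ps ! m)) \<in> set ps"
        using path_antitone[OF path, of "Suc i" m] m p(2) by (auto simp: nth_mem)
      then show ?thesis by blast
    qed simp
    ultimately show ?thesis using above[of u "Suc y"] u by simp
  qed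
  \<comment> \<open>The induction starts at the end point \<open>(a, b)\<close>, where
    \<open>F\<close> is a projection, and runs down to index 0.\<close>
  have "good_on {fst (ps ! i)..snd (ps ! i)} F" if "i \<le> ?l" for i
    using that
  proof (induction i rule: inc_induct)
    case base
    then show ?case using good_on_projection[OF F_box] last by simp
  next
    case (step i)
    have i: "Suc i < length ps" using step.hyps by simp
    have refl: "reflection ps ! i = prod.swap (ps ! i)"
      using i unfolding reflection_def by simp
    from path i show ?case
    proof (cases rule: path_step)
      case (horizontal x y)
      have "F x y = min x y" "F y x = min y x"
        using F_horizontal i horizontal refl by fastforce+
      moreover have "x \<le> y" using sub[of x y] i horizontal by (metis Suc_lessD nth_mem)
      \<comment> \<open>At \<open>u = y\<close> the points are \<open>ps ! i\<close> and its
        reflection, where the horizontal rule applies; \<open>lo\<close> covers smaller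
        \<open>u\<close>.\<close>
      ultimately have "F x u = x \<and> F u x = x" if "u \<in> {x..y}" for u
        using lo[OF i, of x y u] horizontal that by (cases "u = y") auto
      then show ?thesis
        using good_on_adjoin_least[of x y F] step.IH horizontal by simp
    next
      case (vertical x y)
      have "F x (Suc y) = max x (Suc y)" "F (Suc y) x = max (Suc y) x"
        using F_vertical i vertical refl by fastforce+
      moreover have le: "x \<le> Suc y" using sub[of x "Suc y"] i vertical by (metis Suc_lessD nth_mem)
      moreover have "(u, Suc y) \<notin> set ps" if "x < u" for u
        using path_dichotomy[OF path i, of u "Suc y"] that vertical by auto
      \<comment> \<open>At \<open>u = x\<close> the vertical rule applies; \<open>hi\<close> covers
        larger \<open>u\<close>.\<close>
      ultimately have "F (Suc y) u = Suc y \<and> F u (Suc y) = Suc y" if "u \<in> {x..Suc y}" for u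
        using hi[OF i, of x y u] vertical that by (cases "u = x") auto
      then show ?thesis
        using good_on_adjoin_greatest[of x y F] step.IH vertical le by simp
    next
      case (diagonal x y)
      \<comment> \<open>The end of the diagonal step is still in \<open>T1 k\<close>, so the inner
        interval \<open>{Suc x..y}\<close> is nonempty.\<close>
      have "(Suc x, y) \<in> set ps" using i diagonal by (metis nth_mem)
      then have "x \<le> y" using sub[of "Suc x" y] by simp
      moreover have "F x u = x \<and> F u x = x" if "u \<in> {x..y}" for u
        using lo[OF i, of x "Suc y" u] diagonal that by simp
      moreover have "(u, Suc y) \<notin> set ps" if "x < u" for u
        using path_dichotomy[OF path i, of u "Suc y"] that diagonal by auto
      then have "F (Suc y) u = Suc y \<and> F u (Suc y) = Suc y" if "u \<in> {Suc x..Suc y}" for u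
        using hi[OF i, of x y u] diagonal that by simp
      \<comment> \<open>The two corners are \<open>ps ! i\<close> and its reflection, the only new
        points where \<open>F\<close> is not forced to be a minimum or a maximum.\<close>
      moreover have "F x (Suc y) \<in> {x, Suc y}" "F (Suc y) x \<in> {x, Suc y}"
        "F (Suc y) x \<noteq> F x (Suc y)"
        using F_diagonal i diagonal by blast+
      ultimately show ?thesis
        using good_on_adjoin_pair[of x y F] step.IH diagonal by simp
    qed
  qed
  \<comment> \<open>Index 0 carries \<open>(1, k)\<close>, whose interval is all of
    \<open>L k\<close>.\<close>
  from this[of 0] have "good_on (L k) F"
    using path_start ne by (simp add: hd_conv_nth L_def)
  then show ?thesis unfolding good_on_def .
qed

end
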